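(* Let $(L,A,[\cdot,\cdot],\rho)$ be a Lie-Rinehart algebra over a field $\mathbb K$ of characteristic zero, let $M$ be a module over it with action $\theta:L\to\mathrm{End}(M)$, and let $T:M\to L$ be an $\mathcal O$-operator, i.e. a linear map with $T(au)=aT(u)$ and $[T(u),T(v)]=T\big(\theta(T(u))(v)-\theta(T(v))(u)\big)$ for all $u,v\in M$, $a\in A$. Define $u\cdot_T v=\theta(T(u))(v)$ for $u,v\in M$. Then $(M,A,\cdot_T,\ell_T)$ with $\ell_T=\rho\circ T$ is a left-symmetric Rinehart algebra, and $T$ (together with $\mathrm{Id}_A$) is a Lie-Rinehart algebra homomorphism from its sub-adjacent Lie-Rinehart algebra $(M,A,[\cdot,\cdot]_T,\ell_T)$, where $[u,v]_T=u\cdot_T v-v\cdot_T u$, to $(L,A,[\cdot,\cdot],\rho)$.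
   Context: All vector spaces are over a field $\mathbb K$ of characteristic zero. A Lie-Rinehart algebra $(L,A,[\cdot,\cdot],\rho)$ over an associative commutative algebra $A$ is a Lie algebra $(L,[\cdot,\cdot])$ over $\mathbb K$ with an $A$-module structure and a linear map $\rho:L\to\mathrm{Der}(A)$ such that $\rho([x,y])=\rho(x)\rho(y)-\rho(y)\rho(x)$, $\rho(ax)=a\rho(x)$ and $[x,ay]=\rho(x)(a)\,y+a[x,y]$ for all $a\in A$, $x,y\in L$. A module (representation) over $(L,A,[\cdot,\cdot],\rho)$ is an $A$-module $M$ with a linear map $\theta:L\to\mathrm{End}_{\mathbb K}(M)$ which is a representation of the Lie algebra $(L,[\cdot,\cdot])$ and satisfies $\theta(ax)m=a\theta(x)m$ and $\theta(x)(am)=a\theta(x)m+\rho(x)(a)m$ for all $a\in A$, $x\in L$, $m\in M$. A left-symmetric Rinehart algebra is a quadruple $(L,A,\cdot,\ell)$ where $A$ is an associative commutative $\mathbb K$-algebra, $L$ is an $A$-module with a bilinear product satisfying $(x\cdot y)\cdot z-x\cdot(y\cdot z)=(y\cdot x)\cdot z-y\cdot(x\cdot z)$, and $\ell:L\to \mathrm{Der}(A)$ is a linear map such that $\ell(x\cdot y-y\cdot x)=\ell(x)\ell(y)-\ell(y)\ell(x)$, $\ell(ax)=a\ell(x)$, $x\cdot(ay)=\ell(x)(a)\,y+a(x\cdot y)$, and $(ax)\cdot y=a(x\cdot y)$ for all $a\in A$, $x,y,z\in L$. Its sub-adjacent Lie-Rinehart algebra is $(L,A,[\cdot,\cdot],\ell)$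 with $[x,y]=x\cdot y-y\cdot x$. A Lie-Rinehart homomorphism from $(L,A,[\cdot,\cdot]_L,\rho)$ to $(L',A',[\cdot,\cdot]_{L'},\rho')$ is a pair $(g,f)$ of a Lie algebra homomorphism $f:L\to L'$ and an algebra homomorphism $g:A\to A'$ with $f(ax)=g(a)f(x)$ and $g(\rho(x)a)=\rho'(f(x))g(a)$. *)

theory Defs
  imports Complex_Main
begin

text \<open>
  Vector spaces are given by a scalar multiplication on a whole type, as in the library locale
  \<^locale>\<open>vector_space\<close>. Throughout, \<open>sA\<close>, \<open>sL\<close>, \<open>sM\<close> are the scalar multiplications by the ground
  field \<open>'k\<close>, while \<open>actL\<close>, \<open>actM\<close> are the actions of the commutative algebra \<open>'a\<close>.
\<close>

definition bilinear_map ::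
  "('k::field \<Rightarrow> 'u::ab_group_add \<Rightarrow> 'u) \<Rightarrow> ('k \<Rightarrow> 'v::ab_group_add \<Rightarrow> 'v) \<Rightarrow>
   ('k \<Rightarrow> 'w::ab_group_add \<Rightarrow> 'w) \<Rightarrow> ('u \<Rightarrow> 'v \<Rightarrow> 'w) \<Rightarrow> bool"
  where "bilinear_map sU sV sW b \<longleftrightarrow>
    (\<forall>u. Vector_Spaces.linear sV sW (\<lambda>v. b u v)) \<and>
    (\<forall>v. Vector_Spaces.linear sU sW (\<lambda>u. b u v))"

text \<open>
  Algebras are not assumed to have an identity element (class \<^class>\<open>comm_ring\<close>). If there is one,
  however, modules are required to be unital, and homomorphisms between algebras which both have
  an identity are required to preserve it. Unital algebras are thus covered with their usual
  modules and homomorphisms.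
\<close>

definition identity_element :: "'a::comm_ring \<Rightarrow> bool"
  where "identity_element e \<longleftrightarrow> (\<forall>a. e * a = a)"

locale comm_algebra = vector_space sA
  for sA :: "'k::field_char_0 \<Rightarrow> 'a::comm_ring \<Rightarrow> 'a" +
  assumes mult_bilinear: "bilinear_map sA sA sA (*)"

locale comm_algebra_hom = A: comm_algebra sA + B: comm_algebra sB
  for sA :: "'k::field_char_0 \<Rightarrow> 'a::comm_ring \<Rightarrow> 'a"
    and sB :: "'k \<Rightarrow> 'b::comm_ring \<Rightarrow> 'b" +
  fixes g :: "'a \<Rightarrow> 'b"
  assumes hom_linear: "Vector_Spaces.linear sA sB g"
    and hom_mult: "g (a * b) = g a * g b"
    and hom_identity: "identity_element e \<Longrightarrow> identity_element e' \<Longrightarrow> g e = e'"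

locale algebra_module = A: comm_algebra sA + M: vector_space sM
  for sA :: "'k::field_char_0 \<Rightarrow> 'a::comm_ring \<Rightarrow> 'a"
    and sM :: "'k \<Rightarrow> 'm::ab_group_add \<Rightarrow> 'm" +
  fixes act :: "'a \<Rightarrow> 'm \<Rightarrow> 'm"
  assumes act_bilinear: "bilinear_map sA sM sM act"
    and act_mult: "act (a * b) m = act a (act b m)"
    and act_identity: "identity_element e \<Longrightarrow> act e m = m"

definition derivation :: "('k::field \<Rightarrow> 'a::comm_ring \<Rightarrow> 'a) \<Rightarrow> ('a \<Rightarrow> 'a) \<Rightarrow> bool"
  where "derivation sA D \<longleftrightarrow>
    Vector_Spaces.linear sA sA D \<and> (\<forall>a b. D (a * b) = D a * b + a * D b)"

locale lie_algebra = vector_space sL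
  for sL :: "'k::field_char_0 \<Rightarrow> 'l::ab_group_add \<Rightarrow> 'l" +
  fixes br :: "'l \<Rightarrow> 'l \<Rightarrow> 'l"
  assumes br_bilinear: "bilinear_map sL sL sL br"
    and br_self: "br x x = 0"
    and jacobi: "br x (br y z) + br y (br z x) + br z (br x y) = 0"

locale lie_algebra_hom = L: lie_algebra sL br + L': lie_algebra sL' br'
  for sL :: "'k::field_char_0 \<Rightarrow> 'l::ab_group_add \<Rightarrow> 'l" and br
    and sL' :: "'k \<Rightarrow> 'l'::ab_group_add \<Rightarrow> 'l'" and br' +
  fixes f :: "'l \<Rightarrow> 'l'"
  assumes hom_linear: "Vector_Spaces.linear sL sL' f"
    and hom_br: "f (br x y) = br' (f x) (f y)"

text \<open>
  Linearity of the anchor \<open>L \<rightarrow> Der(A)\<close> is stated pointwise, since \<open>Der(A)\<close> is not a type;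
  likewise below for the maps \<open>\<theta>\<close> and \<open>l\<close>.
\<close>

locale lie_rinehart = algebra_module sA sL actL + lie_algebra sL br
  for sA :: "'k::field_char_0 \<Rightarrow> 'a::comm_ring \<Rightarrow> 'a"
    and sL :: "'k \<Rightarrow> 'l::ab_group_add \<Rightarrow> 'l"
    and actL :: "'a \<Rightarrow> 'l \<Rightarrow> 'l"
    and br :: "'l \<Rightarrow> 'l \<Rightarrow> 'l" +
  fixes \<rho> :: "'l \<Rightarrow> 'a \<Rightarrow> 'a"
  assumes anchor_derivation: "derivation sA (\<rho> x)"
    and anchor_linear: "Vector_Spaces.linear sL sA (\<lambda>x. \<rho> x a)"
    and anchor_br: "\<rho> (br x y) a = \<rho> x (\<rho> y a) - \<rho> y (\<rho> x a)"
    and anchor_act: "\<rho> (actL a x) b = a * \<rho> x b"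
    and leibniz: "br x (actL a y) = actL (\<rho> x a) y + actL a (br x y)"

locale lie_rinehart_hom =
  L: lie_rinehart sA sL actL br \<rho> + L': lie_rinehart sA' sL' actL' br' \<rho>' +
  comm_algebra_hom sA sA' g + lie_algebra_hom sL br sL' br' f
  for sA :: "'k::field_char_0 \<Rightarrow> 'a::comm_ring \<Rightarrow> 'a"
    and sL :: "'k \<Rightarrow> 'l::ab_group_add \<Rightarrow> 'l" and actL br \<rho>
    and sA' :: "'k \<Rightarrow> 'b::comm_ring \<Rightarrow> 'b"
    and sL' :: "'k \<Rightarrow> 'l'::ab_group_add \<Rightarrow> 'l'" and actL' br' \<rho>'
    and g :: "'a \<Rightarrow> 'b" and f :: "'l \<Rightarrow> 'l'" +
  assumes hom_act: "f (actL a x) = actL' (g a) (f x)"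
    and hom_anchor: "g (\<rho> x a) = \<rho>' (f x) (g a)"

locale lie_rinehart_module =
  L: lie_rinehart sA sL actL br \<rho> + M: algebra_module sA sM actM
  for sA :: "'k::field_char_0 \<Rightarrow> 'a::comm_ring \<Rightarrow> 'a"
    and sL :: "'k \<Rightarrow> 'l::ab_group_add \<Rightarrow> 'l" and actL br \<rho>
    and sM :: "'k \<Rightarrow> 'm::ab_group_add \<Rightarrow> 'm" and actM +
  fixes \<theta> :: "'l \<Rightarrow> 'm \<Rightarrow> 'm"
  assumes \<theta>_endo: "Vector_Spaces.linear sM sM (\<theta> x)"
    and \<theta>_linear: "Vector_Spaces.linear sL sM (\<lambda>x. \<theta> x m)"
    and \<theta>_br: "\<theta> (br x y) m = \<theta> x (\<theta> y m) - \<theta> y (\<theta> x m)"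
    and \<theta>_act: "\<theta> (actL a x) m = actM a (\<theta> x m)"
    and \<theta>_leibniz: "\<theta> x (actM a m) = actM a (\<theta> x m) + actM (\<rho> x a) m"

locale O_operator = lie_rinehart_module sA sL actL br \<rho> sM actM \<theta>
  for sA :: "'k::field_char_0 \<Rightarrow> 'a::comm_ring \<Rightarrow> 'a"
    and sL :: "'k \<Rightarrow> 'l::ab_group_add \<Rightarrow> 'l" and actL br \<rho>
    and sM :: "'k \<Rightarrow> 'm::ab_group_add \<Rightarrow> 'm" and actM \<theta> +
  fixes T :: "'m \<Rightarrow> 'l"
  assumes T_linear: "Vector_Spaces.linear sM sL T"
    and T_act: "T (actM a u) = actL a (T u)"
    and T_br: "br (T u) (T v) = T (\<theta> (T u) v - \<theta> (T v) u)"

locale left_symmetric_rinehart = algebra_module sA sL actL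
  for sA :: "'k::field_char_0 \<Rightarrow> 'a::comm_ring \<Rightarrow> 'a"
    and sL :: "'k \<Rightarrow> 'l::ab_group_add \<Rightarrow> 'l"
    and actL :: "'a \<Rightarrow> 'l \<Rightarrow> 'l" +
  fixes prd :: "'l \<Rightarrow> 'l \<Rightarrow> 'l" and l :: "'l \<Rightarrow> 'a \<Rightarrow> 'a"
  assumes prd_bilinear: "bilinear_map sL sL sL prd"
    and left_symmetric:
      "prd (prd x y) z - prd x (prd y z) = prd (prd y x) z - prd y (prd x z)"
    and l_derivation: "derivation sA (l x)"
    and l_linear: "Vector_Spaces.linear sL sA (\<lambda>x. l x a)"
    and l_commutator: "l (prd x y - prd y x) a = l x (l y a) - l y (l x a)"
    and l_act: "l (actL a x) b = a * l x b"
    and prd_act_right: "prd x (actL a y) = actL (l x a) y + actL a (prd x y)"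
    and prd_act_left: "prd (actL a x) y = actL a (prd x y)"

definition sub_adjacent :: "('l::ab_group_add \<Rightarrow> 'l \<Rightarrow> 'l) \<Rightarrow> 'l \<Rightarrow> 'l \<Rightarrow> 'l"
  where "sub_adjacent prd x y = prd x y - prd y x"

definition O_product :: "('l \<Rightarrow> 'm \<Rightarrow> 'm) \<Rightarrow> ('m \<Rightarrow> 'l) \<Rightarrow> 'm \<Rightarrow> 'm \<Rightarrow> 'm"
  where "O_product \<theta> T u v = \<theta> (T u) v"

end

theory Submission
  imports Defs
begin

text \<open>Everything rests on reading the O-operator identity from right to left: \<open>T\<close>
  sends the commutator of the product to \<open>br (T u) (T v)\<close>. Applying \<theta>, a
  representation, turns this into the commutator of \<open>\<theta> (T u)\<close> and
  \<open>\<theta> (T v)\<close>, which is left symmetry after rearrangement; applying \<rho> gives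
  the commutator rule for the anchor in the same way. The rules for scalars follow from A-linearity
  of \<open>T\<close> and the rules for \<theta> and \<rho>. That the commutator of the product is a
  Lie-Rinehart bracket is a general fact about left-symmetric Rinehart algebras
  (\<open>sub_adjacent_lie_rinehart\<close>). Once it is known, the O-operator identity says that
  \<open>T\<close> preserves brackets.\<close>

lemma linear_map_diff:
  assumes "Vector_Spaces.linear s1 s2 f"
  shows "f (x - y) = f x - f y"
  using assms unfolding Vector_Spaces.linear_def by (blast intro: module_hom.diff)

lemma linear_map_diff_fun:
  assumes "Vector_Spaces.linear s1 s2 f" and "Vector_Spaces.linear s1 s2 g"
  shows "Vector_Spaces.linear s1 s2 (\<lambda>x. f x - g x)"
proof -
  interpret f: Vector_Spaces.linear s1 s2 f by fact
  interpret vector_space_pair s1 s2 by unfold_locales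
  show ?thesis using assms by (rule linear_compose_sub)
qed

context left_symmetric_rinehart
begin

lemma prd_linear_right: "Vector_Spaces.linear sL sL (prd x)"
  and prd_linear_left: "Vector_Spaces.linear sL sL (\<lambda>x. prd x y)"
  using prd_bilinear by (simp_all add: bilinear_map_def)

text \<open>The twelve terms of the Jacobi sum regroup into three differences of associators
  \<open>?as\<close>. In each difference the first two arguments are swapped, so left symmetry makes
  it vanish.\<close>

lemma sub_adjacent_jacobi:
  defines "br \<equiv> sub_adjacent prd"
  shows "br x (br y z) + br y (br z x) + br z (br x y) = 0"
proof -
  note prd_diff = linear_map_diff[OF prd_linear_right] linear_map_diff[OF prd_linear_left]
  let ?as = "\<lambda>x y z. prd (prd x y) z - prd x (prd y z)"
  have "br x (br y z) + br y (br z x) + br z (br x y)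
      = (?as y x z - ?as x y z) + (?as z y x - ?as y z x) + (?as x z y - ?as z x y)"
    by (simp add: br_def sub_adjacent_def prd_diff algebra_simps)
  then show ?thesis
    by (simp add: left_symmetric[of x y z] left_symmetric[of y z x] left_symmetric[of z x y])
qed

lemma sub_adjacent_bilinear: "bilinear_map sL sL sL (sub_adjacent prd)"
  unfolding bilinear_map_def sub_adjacent_def
  by (intro conjI allI linear_map_diff_fun prd_linear_right prd_linear_left)

lemma sub_adjacent_lie_rinehart: "lie_rinehart sA sL actL (sub_adjacent prd) l"
proof (intro lie_rinehart.intro lie_algebra.intro lie_algebra_axioms.intro
    lie_rinehart_axioms.intro algebra_module_axioms M.vector_space_axioms)
  show "bilinear_map sL sL sL (sub_adjacent prd)"
    by (rule sub_adjacent_bilinear)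
  show "sub_adjacent prd x x = 0" for x
    by (simp add: sub_adjacent_def)
  show "sub_adjacent prd x (sub_adjacent prd y z) + sub_adjacent prd y (sub_adjacent prd z x)
      + sub_adjacent prd z (sub_adjacent prd x y) = 0" for x y z
    by (rule sub_adjacent_jacobi)
  show "derivation sA (l x)" for x
    by (rule l_derivation)
  show "Vector_Spaces.linear sL sA (\<lambda>x. l x a)" for a
    by (rule l_linear)
  show "l (sub_adjacent prd x y) a = l x (l y a) - l y (l x a)" for x y a
    by (simp add: sub_adjacent_def l_commutator)
  show "l (actL a x) b = a * l x b" for a x b
    by (rule l_act)
  show "sub_adjacent prd x (actL a y) = actL (l x a) y + actL a (sub_adjacent prd x y)" for x a y
  proof -
    \<comment> \<open>In the commutator only the product with \<open>actL a y\<close> on the right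
      differentiates \<open>a\<close>, so exactly one anchor term appears. Additivity of
      \<open>actL a\<close> recombines the other two terms.\<close>
    have "Vector_Spaces.linear sL sL (actL a)"
      using act_bilinear by (simp add: bilinear_map_def)
    note act_diff = linear_map_diff[OF this]
    show ?thesis
      by (simp add: sub_adjacent_def prd_act_right prd_act_left act_diff)
  qed
qed

end

lemma (in comm_algebra) comm_algebra_hom_id: "comm_algebra_hom sA sA id"
proof (intro comm_algebra_hom.intro comm_algebra_hom_axioms.intro comm_algebra_axioms)
  show "Vector_Spaces.linear sA sA id"
    by (rule linear_id)
  show "id (a * b) = id a * id b" for a b :: 'a
    by simp
  show "id e = e'" if "identity_element e" "identity_element e'" for e e' :: 'a
    \<comment> \<open>Identity elements are unique: \<open>e' = e * e' = e' * e = e\<close>.\<close>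
    using that unfolding identity_element_def by (metis id_apply mult.commute)
qed

context O_operator
begin

lemma O_product_left_symmetric_rinehart:
  "left_symmetric_rinehart sA sM actM (O_product \<theta> T) (\<rho> \<circ> T)"
proof (intro left_symmetric_rinehart.intro left_symmetric_rinehart_axioms.intro
    M.algebra_module_axioms)
  have "Vector_Spaces.linear sM sM (\<lambda>u. \<theta> (T u) v)" for v
    using Vector_Spaces.linear_compose[OF T_linear \<theta>_linear] by (simp add: comp_def)
  then show "bilinear_map sM sM sM (O_product \<theta> T)"
    by (simp add: bilinear_map_def O_product_def \<theta>_endo)
  \<comment> \<open>This is left symmetry with the terms regrouped. Linearity of \<theta> and
    \<open>T\<close> gathers the left side into \<theta> applied to \<open>T\<close> of a
    commutator, which \<open>T_br\<close> identifies with \<open>br (T u) (T v)\<close>.\<close>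
  have "\<theta> (T (\<theta> (T u) v)) w - \<theta> (T (\<theta> (T v) u)) w
      = \<theta> (T u) (\<theta> (T v) w) - \<theta> (T v) (\<theta> (T u) w)" for u v w
    unfolding linear_map_diff[OF \<theta>_linear, symmetric] linear_map_diff[OF T_linear, symmetric]
      T_br[symmetric] by (rule \<theta>_br)
  then show "O_product \<theta> T (O_product \<theta> T u v) w - O_product \<theta> T u (O_product \<theta> T v w)
      = O_product \<theta> T (O_product \<theta> T v u) w - O_product \<theta> T v (O_product \<theta> T u w)" for u v w
    by (simp add: O_product_def algebra_simps)
  show "derivation sA ((\<rho> \<circ> T) u)" for u
    by (simp add: L.anchor_derivation)
  show "Vector_Spaces.linear sM sA (\<lambda>u. (\<rho> \<circ> T) u a)" for a
    using Vector_Spaces.linear_compose[OF T_linear L.anchor_linear] by (simp add: comp_def)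
  show "(\<rho> \<circ> T) (O_product \<theta> T u v - O_product \<theta> T v u) a
      = (\<rho> \<circ> T) u ((\<rho> \<circ> T) v a) - (\<rho> \<circ> T) v ((\<rho> \<circ> T) u a)" for u v a
    by (simp add: O_product_def L.anchor_br flip: T_br)
  show "(\<rho> \<circ> T) (actM a u) b = a * (\<rho> \<circ> T) u b" for a u b
    by (simp add: T_act L.anchor_act)
  show "O_product \<theta> T u (actM a v) = actM ((\<rho> \<circ> T) u a) v + actM a (O_product \<theta> T u v)" for u a v
    by (simp add: O_product_def \<theta>_leibniz add.commute)
  show "O_product \<theta> T (actM a u) v = actM a (O_product \<theta> T u v)" for a u v
    by (simp add: O_product_def T_act \<theta>_act)
qed

lemma O_operator_lie_rinehart_hom:
  "lie_rinehart_hom sA sM actM (sub_adjacent (O_product \<theta> T)) (\<rho> \<circ> T) sA sL actL br \<rho> id T"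
proof -
  \<comment> \<open>The source of the homomorphism must itself be a Lie-Rinehart algebra; this is
    where left symmetry of the product enters.\<close>
  interpret S: lie_rinehart sA sM actM "sub_adjacent (O_product \<theta> T)" "\<rho> \<circ> T"
    by (rule left_symmetric_rinehart.sub_adjacent_lie_rinehart
        [OF O_product_left_symmetric_rinehart])
  interpret id: comm_algebra_hom sA sA id
    by (rule L.A.comm_algebra_hom_id)
  show ?thesis
    \<comment> \<open>Compatibility with the anchors holds by definition, since the anchor on the
      source is \<rho> composed with \<open>T\<close>; brackets and scalars are \<open>T_br\<close>
      and \<open>T_act\<close>.\<close>
    by (intro lie_rinehart_hom.intro lie_rinehart_hom_axioms.intro lie_algebra_hom.intro
        lie_algebra_hom_axioms.intro S.lie_rinehart_axioms L.lie_rinehart_axioms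
        id.comm_algebra_hom_axioms S.lie_algebra_axioms L.lie_algebra_axioms T_linear)
      (simp_all add: T_act T_br sub_adjacent_def O_product_def)
qed

end

theorem proposition3p10:
  fixes sA :: "'k::field_char_0 \<Rightarrow> 'a::comm_ring \<Rightarrow> 'a"
    and sL :: "'k \<Rightarrow> 'l::ab_group_add \<Rightarrow> 'l"
    and actL :: "'a \<Rightarrow> 'l \<Rightarrow> 'l"
    and br :: "'l \<Rightarrow> 'l \<Rightarrow> 'l"
    and \<rho> :: "'l \<Rightarrow> 'a \<Rightarrow> 'a"
    and sM :: "'k \<Rightarrow> 'm::ab_group_add \<Rightarrow> 'm"
    and actM :: "'a \<Rightarrow> 'm \<Rightarrow> 'm"
    and \<theta> :: "'l \<Rightarrow> 'm \<Rightarrow> 'm"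
    and T :: "'m \<Rightarrow> 'l"
  assumes "lie_rinehart sA sL actL br \<rho>"
    and "lie_rinehart_module sA sL actL br \<rho> sM actM \<theta>"
    and "O_operator sA sL actL br \<rho> sM actM \<theta> T"
  shows "left_symmetric_rinehart sA sM actM (O_product \<theta> T) (\<rho> \<circ> T) \<and>
    lie_rinehart_hom
      sA sM actM (sub_adjacent (O_product \<theta> T)) (\<rho> \<circ> T)
      sA sL actL br \<rho>
      id T"
  using O_operator.O_product_left_symmetric_rinehart[OF assms(3)]
    O_operator.O_operator_lie_rinehart_hom[OF assms(3)] ..

end
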